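(* Let $G_\bullet$ be a finitely generated $\mathrm{FI}$-graph, and assume that there are integers $a,c$ such that $|V(G_n)| = an + c$ for all sufficiently large $n$. Then there exist constants $A,B$ such that $\alpha(G_n) = An + B$ for all sufficiently large $n$, where $\alpha(G_n)$ denotes the independence number of $G_n$.
   Context: All graphs are finite simple graphs (no loops, no multiple edges); a graph homomorphism is a map of vertex sets sending edges to edges. $\mathrm{FI}$ is the category whose objects are the finite sets $[n]=\{1,\dots,n\}$, $n\ge 0$, and whose morphisms are injections $[m]\hookrightarrow[n]$. An $\mathrm{FI}$-graph is a functor $G_\bullet$ from $\mathrm{FI}$ to the category of graphs and graph homomorphisms; write $G_n$ for the graph assigned to $[n]$ and $G_f$ for the homomorphism induced by an injection $f$. It is finitely generated if for every sufficiently large $n$ and every vertex $v\in V(G_{n+1})$ there exist $v'\in V(G_n)$ and an injection $f:[n]\hookrightarrow[n+1]$ with $G_f(v')=v$. The independence number $\alpha(G)$ of a graph $G$ is the largest size of a set of pairwise non-adjacent vertices. *)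

theory Defs
  imports "Graph_Theory.Pair_Digraph" "HOL-Library.FuncSet"
begin

(* A finite simple graph is a pair_graph: finite vertex set, irreflexive symmetric set of arcs.
   The undirected edge between u and v is represented by the two arcs (u, v) and (v, u). *)

definition graph_hom ::
    "'a pair_pre_digraph \<Rightarrow> 'b pair_pre_digraph \<Rightarrow> ('a \<Rightarrow> 'b) set" where
  "graph_hom G H =
    {h \<in> pverts G \<rightarrow>\<^sub>E pverts H. \<forall>u v. (u, v) \<in> parcs G \<longrightarrow> (h u, h v) \<in> parcs H}"

definition independent_set :: "'a pair_pre_digraph \<Rightarrow> 'a set \<Rightarrow> bool" where
  "independent_set G S \<longleftrightarrow> S \<subseteq> pverts G \<and> (\<forall>u\<in>S. \<forall>v\<in>S. (u, v) \<notin> parcs G)"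

definition independence_number :: "'a pair_pre_digraph \<Rightarrow> nat" where
  "independence_number G = Max {card S | S. independent_set G S}"

(* The morphisms [m] -> [n] of FI. As in graph_hom, functions are extensional, so that equality
   of HOL functions is equality of maps on the intended domain. *)
definition FI_hom :: "nat \<Rightarrow> nat \<Rightarrow> (nat \<Rightarrow> nat) set" where
  "FI_hom m n = {f \<in> {1..m} \<rightarrow>\<^sub>E {1..n}. inj_on f {1..m}}"

(* A functor from FI to graphs: G n is the value at [n], and Gmap m n f the homomorphism induced
   by f : [m] -> [n]. The indices m, n are needed since f does not determine its codomain.
   A single vertex type is no restriction: countably many finite sets embed into nat. *)
locale FI_graph =
  fixes G :: "nat \<Rightarrow> 'a pair_pre_digraph"
    and Gmap :: "nat \<Rightarrow> nat \<Rightarrow> (nat \<Rightarrow> nat) \<Rightarrow> 'a \<Rightarrow> 'a"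
  assumes graph: "\<And>n. pair_graph (G n)"
    and Gmap_hom: "\<And>m n f. f \<in> FI_hom m n \<Longrightarrow> Gmap m n f \<in> graph_hom (G m) (G n)"
    and Gmap_id: "\<And>n. Gmap n n (restrict id {1..n}) = restrict id (pverts (G n))"
    and Gmap_compose: "\<And>l m n f g. f \<in> FI_hom l m \<Longrightarrow> g \<in> FI_hom m n \<Longrightarrow>
      Gmap l n (compose {1..l} g f) = compose (pverts (G l)) (Gmap m n g) (Gmap l m f)"

definition finitely_generated ::
    "(nat \<Rightarrow> 'a pair_pre_digraph) \<Rightarrow> (nat \<Rightarrow> nat \<Rightarrow> (nat \<Rightarrow> nat) \<Rightarrow> 'a \<Rightarrow> 'a) \<Rightarrow> bool" where
  "finitely_generated G Gmap \<longleftrightarrow>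
    (\<forall>\<^sub>F n in sequentially. \<forall>v \<in> pverts (G (n + 1)).
      \<exists>v' \<in> pverts (G n). \<exists>f \<in> FI_hom n (n + 1). Gmap n (n + 1) f v' = v)"

end

theory Submission
  imports Defs "HOL-Combinatorics.Permutations"
begin

text \<open>
  For large \<open>n\<close> a vertex \<open>v\<close> of \<open>G n\<close> is the image of a vertex of a fixed \<open>G N\<close>, so it has a unique
  smallest support of size at most \<open>N\<close>. If the support has \<open>k\<close> elements, the orbit of \<open>v\<close> has at least
  \<open>n choose k\<close> elements, and linear growth forces \<open>k \<le> 1\<close>. Hence eventually \<open>V n\<close> consists of a fixed
  number of copies of \<open>[n]\<close> and a fixed number of invariant vertices. Adjacency is invariant under
  permutations and monotone in \<open>n\<close>, so it eventually depends only on the copies and on whether the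
  two points of \<open>[n]\<close> coincide. An independent set then assigns to each point of \<open>[n]\<close> a subset of the
  copies. For \<open>n\<close> large two points carry the same subset, which may be duplicated at a new point or
  deleted, so the independence number is eventually convex in \<open>n\<close>. Being linearly bounded and integer
  valued, it is eventually affine.
\<close>

section \<open>Independence numbers of blow-ups\<close>

text \<open>By convexity the differences never decrease, and a difference above \<open>K\<close>
  would persist and break the linear bound. A nondecreasing integer sequence that is bounded above
  is eventually constant.\<close>

lemma convex_bounded_eventually_affine:
  fixes f :: "nat \<Rightarrow> int"
  assumes convex: "\<And>n. M \<le> n \<Longrightarrow> 2 * f (n + 1) \<le> f n + f (n + 2)"
    and bound: "\<And>n. M \<le> n \<Longrightarrow> f n \<le> K * int n + C"
  shows "\<exists>A B. \<forall>\<^sub>F n in sequentially. f n = A * int n + B"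
proof -
  define d where "d n = f (n + 1) - f n" for n
  have d_Suc: "d n \<le> d (Suc n)" if "M \<le> n" for n
    using convex[OF that] by (simp add: d_def)
  have d_mono: "d m \<le> d n" if "M \<le> m" "m \<le> n" for m n
    using that(2) that(1) by (induction rule: dec_induct) (auto intro: order_trans d_Suc)
  have growth: "f m + d m * int k \<le> f (m + k)" if "M \<le> m" for m k
  proof (induction k)
    case (Suc k)
    have "f (m + Suc k) = f (m + k) + d (m + k)" by (simp add: d_def)
    then show ?case using Suc d_mono[OF that, of "m + k"] by (simp add: algebra_simps)
  qed simp
  have d_le: "d m \<le> K" if "M \<le> m" for m
  proof (rule ccontr)
    assume "\<not> d m \<le> K"
    \<comment> \<open>Growth by at least \<open>K + 1\<close> per step exhausts the slack
      \<open>K * int m + C - f m\<close> within this many steps.\<close>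
    define k where "k = nat (K * int m + C - f m + 1)"
    have "(K + 1) * int k \<le> d m * int k"
      using \<open>\<not> d m \<le> K\<close> by (intro mult_right_mono) auto
    then have "f m + (K + 1) * int k \<le> K * int (m + k) + C"
      using growth[OF that, of k] bound[of "m + k"] that by linarith
    then have "int k \<le> K * int m + C - f m" by (simp add: algebra_simps)
    then show False unfolding k_def by linarith
  qed
  \<comment> \<open>A stage with the largest difference; \<open>nat\<close> truncates nothing here
    because of \<open>d_le\<close>.\<close>
  obtain m where m: "M \<le> m" and m_min: "\<And>n. M \<le> n \<Longrightarrow> nat (K - d m) \<le> nat (K - d n)"
    using ex_has_least_nat[of "\<lambda>n. M \<le> n" M "\<lambda>n. nat (K - d n)"] by blast
  have d_eq: "d n = d m" if "m \<le> n" for n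
    using m_min[of n] d_mono[OF m that] d_le[of n] d_le[OF m] m that by simp
  have "f (m + k) = f m + d m * int k" for k
  proof (induction k)
    case (Suc k)
    have "f (m + Suc k) = f (m + k) + d (m + k)" by (simp add: d_def)
    then show ?case using Suc d_eq[of "m + k"] by (simp add: algebra_simps)
  qed simp
  then have "f n = d m * int n + (f m - d m * int m)" if "m \<le> n" for n
    using that by (auto simp: le_iff_add algebra_simps)
  then show ?thesis
    unfolding eventually_sequentially by blast
qed

section \<open>Maximum independent sets of finite graphs\<close>

lemma finite_independent_set_cards:
  assumes "finite (pverts G)"
  shows "finite {card S | S. independent_set G S}"
proof -
  have "{card S | S. independent_set G S} \<subseteq> card ` Pow (pverts G)"
    by (auto simp: independent_set_def)
  then show ?thesis using assms by (meson finite_Pow_iff finite_imageI finite_subset)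
qed

lemma independence_number_ge:
  assumes "finite (pverts G)" "independent_set G S"
  shows "card S \<le> independence_number G"
  unfolding independence_number_def
  using assms by (intro Max_ge finite_independent_set_cards) auto

lemma independence_number_attained:
  assumes "finite (pverts G)"
  obtains S where "independent_set G S" "card S = independence_number G"
proof -
  have "independent_set G {}" by (simp add: independent_set_def)
  then have "independence_number G \<in> {card S | S. independent_set G S}"
    unfolding independence_number_def
    using assms by (intro Max_in finite_independent_set_cards) auto
  then show ?thesis using that by auto
qed

text \<open>The vertex \<open>e n x w\<close> is of type \<open>w\<close> at the point \<open>x\<close> of \<open>[n]\<close>. The types in \<open>P\<close> do not see the
  point: all \<open>e n x w\<close> with \<open>w \<in> P\<close> are the same vertex.\<close>

locale eventual_blowup =
  fixes G :: "nat \<Rightarrow> 'a pair_pre_digraph"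
    and e :: "nat \<Rightarrow> nat \<Rightarrow> 'b \<Rightarrow> 'a"
    and P R :: "'b set"
    and same diff :: "'b \<Rightarrow> 'b \<Rightarrow> bool"
    and M :: nat
  assumes M_pos: "0 < M"
    and finite_P: "finite P" and finite_R: "finite R" and disjoint: "P \<inter> R = {}"
    and verts: "\<And>n. M \<le> n \<Longrightarrow> pverts (G n) = (\<lambda>(x, w). e n x w) ` ({1..n} \<times> (P \<union> R))"
    and e_eq_iff: "\<And>n x y w w'. M \<le> n \<Longrightarrow> x \<in> {1..n} \<Longrightarrow> y \<in> {1..n} \<Longrightarrow> w \<in> P \<union> R \<Longrightarrow>
      w' \<in> P \<union> R \<Longrightarrow> e n x w = e n y w' \<longleftrightarrow> w = w' \<and> (x = y \<or> w \<in> P)"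
    and arc_iff: "\<And>n x y w w'. M \<le> n \<Longrightarrow> x \<in> {1..n} \<Longrightarrow> y \<in> {1..n} \<Longrightarrow> w \<in> P \<union> R \<Longrightarrow>
      w' \<in> P \<union> R \<Longrightarrow>
      (e n x w, e n y w') \<in> parcs (G n) \<longleftrightarrow> (if x = y then same w w' else diff w w')"
begin

text \<open>Types in \<open>P\<close> are left out: their vertex belongs to all points at once and
  must be counted only once.\<close>

definition layer :: "nat \<Rightarrow> 'a set \<Rightarrow> nat \<Rightarrow> 'b set" where
  "layer n S x = {w \<in> R. e n x w \<in> S}"

text \<open>Duplicating a layer and deleting a layer are both instances, for a map that merges two
  points and for one that misses a point.\<close>

definition pullback :: "nat \<Rightarrow> nat \<Rightarrow> (nat \<Rightarrow> nat) \<Rightarrow> 'a set \<Rightarrow> 'a set" where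
  "pullback m n \<phi> S = {e m z w | z w. z \<in> {1..m} \<and> w \<in> P \<union> R \<and> e n (\<phi> z) w \<in> S}"

lemma pullbackI:
  "z \<in> {1..m} \<Longrightarrow> w \<in> P \<union> R \<Longrightarrow> e n (\<phi> z) w \<in> S \<Longrightarrow> e m z w \<in> pullback m n \<phi> S"
  unfolding pullback_def by blast

lemma finite_verts: "M \<le> n \<Longrightarrow> finite (pverts (G n))"
  using finite_P finite_R by (simp add: verts)

lemma e_fixed_eq:
  assumes "M \<le> n" "x \<in> {1..n}" "w \<in> P"
  shows "e n x w = e n 1 w"
  using assms e_eq_iff[of n x 1 w w] by auto

text \<open>The types in \<open>P\<close> are counted once, with the point 1 as representative, so
  only the sum over layers depends on \<open>\<phi>\<close>.\<close>

lemma card_pullback: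
  assumes m: "M \<le> m" and n: "M \<le> n" and \<phi>: "\<phi> \<in> {1..m} \<rightarrow> {1..n}"
  shows "card (pullback m n \<phi> S) =
    card {w \<in> P. e n 1 w \<in> S} + (\<Sum>z = 1..m. card (layer n S (\<phi> z)))"
proof -
  define Q where "Q = {w \<in> P. e n 1 w \<in> S}"
  define X where "X = (SIGMA z : {1..m}. layer n S (\<phi> z))"
  have m1: "1 \<in> {1..m}" using m M_pos by simp
  have split: "pullback m n \<phi> S = e m 1 ` Q \<union> (\<lambda>(z, w). e m z w) ` X"
  proof (intro equalityI subsetI)
    fix v assume "v \<in> pullback m n \<phi> S"
    then obtain z w where v: "v = e m z w" "z \<in> {1..m}" "w \<in> P \<union> R" "e n (\<phi> z) w \<in> S"
      by (auto simp: pullback_def)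
    show "v \<in> e m 1 ` Q \<union> (\<lambda>(z, w). e m z w) ` X"
    proof (cases "w \<in> P")
      case True
      then have "w \<in> Q" "v = e m 1 w"
        using v e_fixed_eq[OF m, of z w] e_fixed_eq[OF n, of "\<phi> z" w] \<phi>
        by (auto simp: Q_def Pi_iff)
      then show ?thesis by auto
    next
      case False
      then show ?thesis using v by (auto simp: X_def layer_def intro!: image_eqI[of _ _ "(z, w)"])
    qed
  next
    fix v assume "v \<in> e m 1 ` Q \<union> (\<lambda>(z, w). e m z w) ` X"
    then show "v \<in> pullback m n \<phi> S"
    proof
      assume "v \<in> e m 1 ` Q"
      then obtain w where "w \<in> P" "e n 1 w \<in> S" "v = e m 1 w" by (auto simp: Q_def)
      moreover have "e n (\<phi> 1) w = e n 1 w"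
        using \<phi> m1 e_fixed_eq[OF n _ \<open>w \<in> P\<close>] by blast
      ultimately show ?thesis using pullbackI[OF m1] by auto
    qed (auto simp: X_def layer_def intro!: pullbackI)
  qed
  have "inj_on (e m 1) Q"
    using m1 by (auto simp: inj_on_def Q_def e_eq_iff[OF m])
  moreover have "inj_on (\<lambda>(z, w). e m z w) X"
  proof (rule inj_onI, clarify)
    fix z w z' w' assume "(z, w) \<in> X" "(z', w') \<in> X" "e m z w = e m z' w'"
    then show "z = z' \<and> w = w'"
      using e_eq_iff[OF m, of z z' w w'] disjoint by (auto simp: X_def layer_def)
  qed
  moreover have "e m 1 ` Q \<inter> (\<lambda>(z, w). e m z w) ` X = {}"
  proof -
    have "e m 1 w \<noteq> e m z w'" if "w \<in> Q" "(z, w') \<in> X" for w z w'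
      using that m1 e_eq_iff[OF m, of 1 z w w'] disjoint by (auto simp: X_def Q_def layer_def)
    then show ?thesis by fast
  qed
  moreover have "finite Q" "finite X"
    using finite_P finite_R by (auto simp: Q_def X_def layer_def)
  ultimately have "card (pullback m n \<phi> S) = card Q + card X"
    by (simp add: split card_Un_disjoint card_image)
  also have "card X = (\<Sum>z = 1..m. card (layer n S (\<phi> z)))"
    unfolding X_def using finite_R by (subst card_SigmaI) (auto simp: layer_def)
  finally show ?thesis by (simp add: Q_def)
qed

lemma pullback_id:
  assumes "M \<le> n" "S \<subseteq> pverts (G n)"
  shows "pullback n n (\<lambda>x. x) S = S"
  using assms verts[of n] by (fastforce simp: pullback_def)

text \<open>Adjacency sees only the types and whether the points coincide, so trouble arises only
  where \<open>\<phi>\<close> merges two points. There a second point \<open>y\<close> with the same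
  layer shows, inside \<open>S\<close>, that no two types involved are related by
  \<open>diff\<close>.\<close>

lemma independent_pullback:
  assumes m: "M \<le> m" and n: "M \<le> n" and \<phi>: "\<phi> \<in> {1..m} \<rightarrow> {1..n}"
    and S: "independent_set (G n) S"
    and collision: "\<And>z z'. z \<in> {1..m} \<Longrightarrow> z' \<in> {1..m} \<Longrightarrow> z \<noteq> z' \<Longrightarrow> \<phi> z = \<phi> z' \<Longrightarrow>
      \<exists>y\<in>{1..n}. y \<noteq> \<phi> z \<and> layer n S y = layer n S (\<phi> z)"
  shows "independent_set (G m) (pullback m n \<phi> S)"
  unfolding independent_set_def
proof (intro conjI ballI)
  show "pullback m n \<phi> S \<subseteq> pverts (G m)"
    by (auto simp: pullback_def verts[OF m])
next
  fix u v assume "u \<in> pullback m n \<phi> S" "v \<in> pullback m n \<phi> S"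
  then obtain z w z' w' where u: "u = e m z w" "z \<in> {1..m}" "w \<in> P \<union> R" "e n (\<phi> z) w \<in> S"
    and v: "v = e m z' w'" "z' \<in> {1..m}" "w' \<in> P \<union> R" "e n (\<phi> z') w' \<in> S"
    by (auto simp: pullback_def)
  have \<phi>z: "\<phi> z \<in> {1..n}" and \<phi>z': "\<phi> z' \<in> {1..n}" using u v \<phi> by auto
  have no_arc: "(p, q) \<notin> parcs (G n)" if "p \<in> S" "q \<in> S" for p q
    using S that by (auto simp: independent_set_def)
  consider "z = z'" | "z \<noteq> z'" "\<phi> z \<noteq> \<phi> z'" | "z \<noteq> z'" "\<phi> z = \<phi> z'" by blast
  then show "(u, v) \<notin> parcs (G m)"
  proof cases
    case 1
    then show ?thesis
      using no_arc[OF u(4) v(4)] u v \<phi>z by (simp add: arc_iff[OF m] arc_iff[OF n])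
  next
    case 2
    then show ?thesis
      using no_arc[OF u(4) v(4)] u v \<phi>z \<phi>z' by (simp add: arc_iff[OF m] arc_iff[OF n])
  next
    case 3
    then obtain y where y: "y \<in> {1..n}" "y \<noteq> \<phi> z" "layer n S y = layer n S (\<phi> z)"
      using collision u v by blast
    have "e n y w' \<in> S"
    proof (cases "w' \<in> P")
      case True
      then show ?thesis using v y \<phi>z' e_fixed_eq[OF n] by metis
    next
      case False
      then have "w' \<in> layer n S (\<phi> z)" using v 3 by (simp add: layer_def)
      then show ?thesis using y by (auto simp: layer_def)
    qed
    then have "(e n (\<phi> z) w, e n y w') \<notin> parcs (G n)" by (rule no_arc[OF u(4)])
    then have "\<not> diff w w'" using arc_iff[OF n \<phi>z y(1) u(3) v(3)] y(2) by simp
    then show ?thesis using u v 3 by (simp add: arc_iff[OF m])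
  qed
qed

text \<open>Pigeonhole: an optimal independent set has the same layer at two points of \<open>[n]\<close>. That layer
  can be copied to a new point, and it can also be deleted; both change the size by the same amount.\<close>

lemma independence_number_convex:
  assumes n: "M + 2 ^ card R \<le> n"
  shows "2 * independence_number (G (n + 1)) \<le>
    independence_number (G n) + independence_number (G (n + 2))"
proof -
  let ?n = "n + 1"
  have Mn: "M \<le> n" "M \<le> ?n" "M \<le> n + 2" using n by auto
  obtain S where S: "independent_set (G ?n) S" and card_S: "card S = independence_number (G ?n)"
    using independence_number_attained[OF finite_verts[OF Mn(2)]] by blast
  let ?L = "layer ?n S"
  let ?q = "card {w \<in> P. e ?n 1 w \<in> S}"
  have "card (?L ` {1..?n}) \<le> card (Pow R)"
    using finite_R by (intro card_mono) (auto simp: layer_def)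
  also have "\<dots> < card {1..?n}" using n finite_R by (simp add: card_Pow)
  finally have "\<not> inj_on ?L {1..?n}" by (rule pigeonhole)
  then obtain x y where xy: "x \<in> {1..?n}" "y \<in> {1..?n}" "x \<noteq> y" "?L x = ?L y"
    by (auto simp: inj_on_def)
  have size: "card S = ?q + (\<Sum>z = 1..?n. card (?L z))"
    using card_pullback[OF Mn(2) Mn(2), of "\<lambda>x. x" S] pullback_id[OF Mn(2)] S
    by (auto simp: independent_set_def)
  \<comment> \<open>The new point \<open>n + 2\<close> copies the layer at \<open>x\<close>. The
    only collision is between \<open>x\<close> and \<open>n + 2\<close>, and \<open>y\<close>
    justifies it.\<close>
  define \<phi> where "\<phi> z = (if z = n + 2 then x else z)" for z
  have \<phi>: "\<phi> \<in> {1..n + 2} \<rightarrow> {1..?n}" using xy by (auto simp: \<phi>_def)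
  have "independent_set (G (n + 2)) (pullback (n + 2) ?n \<phi> S)"
    using xy by (intro independent_pullback[OF Mn(3,2) \<phi> S]) (auto simp: \<phi>_def split: if_splits)
  then have up: "card (pullback (n + 2) ?n \<phi> S) \<le> independence_number (G (n + 2))"
    by (intro independence_number_ge finite_verts Mn)
  have "(\<Sum>z = 1..n + 2. card (?L (\<phi> z))) = (\<Sum>z = 1..?n. card (?L (\<phi> z))) + card (?L (\<phi> (n + 2)))"
    by simp
  also have "\<dots> = (\<Sum>z = 1..?n. card (?L z)) + card (?L x)"
    by (intro arg_cong2[of _ _ _ _ "(+)"] sum.cong) (auto simp: \<phi>_def)
  finally have up_size: "card (pullback (n + 2) ?n \<phi> S) = card S + card (?L x)"
    using card_pullback[OF Mn(3,2) \<phi>, of S] size by simp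
  \<comment> \<open>A bijection from \<open>{1..n}\<close> onto \<open>{1..?n} - {x}\<close>; for
    \<open>x = ?n\<close> it is the identity on \<open>{1..n}\<close>.\<close>
  define \<psi> where "\<psi> z = (if z = x then ?n else z)" for z
  have \<psi>: "\<psi> \<in> {1..n} \<rightarrow> {1..?n}" using xy by (auto simp: \<psi>_def)
  have inj: "inj_on \<psi> {1..n}" by (auto simp: \<psi>_def inj_on_def split: if_splits)
  have "independent_set (G n) (pullback n ?n \<psi> S)"
    by (rule independent_pullback[OF Mn(1,2) \<psi> S]) (meson inj inj_onD)
  then have down: "card (pullback n ?n \<psi> S) \<le> independence_number (G n)"
    by (intro independence_number_ge finite_verts Mn)
  have "\<psi> ` {1..n} = {1..?n} - {x}"
  proof (intro card_subset_eq)
    show "\<psi> ` {1..n} \<subseteq> {1..?n} - {x}" using xy by (auto simp: \<psi>_def)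
    show "card (\<psi> ` {1..n}) = card ({1..?n} - {x})"
      using xy(1) card_image[OF inj] by simp
  qed simp
  then have "(\<Sum>z = 1..n. card (?L (\<psi> z))) = (\<Sum>z\<in>{1..?n} - {x}. card (?L z))"
    using sum.reindex[OF inj, of "\<lambda>z. card (?L z)"] by simp
  then have down_size: "card (pullback n ?n \<psi> S) + card (?L x) = card S"
    using card_pullback[OF Mn(1,2) \<psi>, of S] size xy(1)
      sum.remove[of "{1..?n}" x "\<lambda>z. card (?L z)"] by simp
  show ?thesis using up down up_size down_size card_S by linarith
qed

lemma independence_number_le:
  assumes "M \<le> n"
  shows "independence_number (G n) \<le> card (P \<union> R) * n"
proof -
  obtain S where S: "independent_set (G n) S" and card_S: "card S = independence_number (G n)"
    using independence_number_attained[OF finite_verts[OF assms]] by blast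
  have "S \<subseteq> (\<lambda>(x, w). e n x w) ` ({1..n} \<times> (P \<union> R))"
    using S verts[OF assms] by (simp add: independent_set_def)
  then have "card S \<le> card ({1..n} \<times> (P \<union> R))"
    using finite_P finite_R by (intro surj_card_le) auto
  then show ?thesis using card_S by (simp add: card_cartesian_product mult.commute)
qed

theorem independence_number_eventually_affine:
  "\<exists>A B :: int. \<forall>\<^sub>F n in sequentially. int (independence_number (G n)) = A * int n + B"
proof (rule convex_bounded_eventually_affine)
  fix n assume n: "M + 2 ^ card R \<le> n"
  show "2 * int (independence_number (G (n + 1))) \<le>
      int (independence_number (G n)) + int (independence_number (G (n + 2)))"
    using independence_number_convex[OF n] by linarith
  show "int (independence_number (G n)) \<le> int (card (P \<union> R)) * int n + 0"
    using independence_number_le[of n] n by (simp flip: of_nat_mult)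
qed

end

section \<open>Supports of vertices of an FI-graph\<close>

text \<open>Keeps \<open>{1..n}\<close> from being rewritten to \<open>{Suc 0..n}\<close>.\<close>

declare One_nat_def [simp del]

section \<open>Permutations and injections between initial segments\<close>

text \<open>The complements of the two images in \<open>B\<close> have equal size, so any bijection
  between them completes the assignment of \<open>g x\<close> to \<open>f x\<close>.\<close>

lemma ex_permutation_extending:
  assumes B: "finite B" and f: "inj_on f A" "f ` A \<subseteq> B" and g: "inj_on g A" "g ` A \<subseteq> B"
  obtains \<pi> where "\<pi> permutes B" "\<And>x. x \<in> A \<Longrightarrow> \<pi> (f x) = g x"
proof -
  have "card (B - f ` A) = card (B - g ` A)"
    using assms by (metis card_Diff_subset card_image finite_subset)
  then obtain h where h: "bij_betw h (B - f ` A) (B - g ` A)"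
    using B finite_same_card_bij[of "B - f ` A" "B - g ` A"] by auto
  define \<pi> where
    "\<pi> y = (if y \<in> f ` A then g (inv_into A f y) else if y \<in> B then h y else y)" for y
  have "bij_betw (g \<circ> inv_into A f) (f ` A) (g ` A)"
    using f(1) g(1) by (intro bij_betw_trans[OF bij_betw_inv_into]) (auto simp: bij_betw_def)
  then have "bij_betw \<pi> (f ` A) (g ` A)"
    by (rule bij_betw_cong[THEN iffD1, rotated]) (simp add: \<pi>_def)
  moreover have "bij_betw \<pi> (B - f ` A) (B - g ` A)"
    using h by (rule bij_betw_cong[THEN iffD1, rotated]) (simp add: \<pi>_def)
  ultimately have "bij_betw \<pi> (f ` A \<union> (B - f ` A)) (g ` A \<union> (B - g ` A))"
    by (rule bij_betw_combine) blast
  moreover have "f ` A \<union> (B - f ` A) = B" "g ` A \<union> (B - g ` A) = B" using f g by auto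
  ultimately have "bij_betw \<pi> B B" by simp
  then have "\<pi> permutes B" using f(2) by (intro bij_imp_permutes) (auto simp: \<pi>_def)
  moreover have "\<pi> (f x) = g x" if "x \<in> A" for x
    using that f(1) by (simp add: \<pi>_def)
  ultimately show ?thesis using that by blast
qed

text \<open>Without the extensionality of \<open>FI_hom\<close>, so that \<open>id\<close>,
  transpositions and ordinary composition can be used directly; \<open>push\<close> restores
  it.\<close>

definition inj_to :: "nat \<Rightarrow> nat \<Rightarrow> (nat \<Rightarrow> nat) \<Rightarrow> bool" where
  "inj_to m n f \<longleftrightarrow> inj_on f {1..m} \<and> f \<in> {1..m} \<rightarrow> {1..n}"

lemma inj_to_mem: "inj_to m n f \<Longrightarrow> x \<in> {1..m} \<Longrightarrow> f x \<in> {1..n}"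
  unfolding inj_to_def by blast

lemma inj_to_eq_iff: "inj_to m n f \<Longrightarrow> x \<in> {1..m} \<Longrightarrow> y \<in> {1..m} \<Longrightarrow> f x = f y \<longleftrightarrow> x = y"
  unfolding inj_to_def by (meson inj_on_eq_iff)

lemma inj_to_le: "inj_to m n f \<Longrightarrow> m \<le> n"
  unfolding inj_to_def using card_inj_on_le[of f "{1..m}" "{1..n}"] by auto

lemma inj_to_comp: "inj_to l m f \<Longrightarrow> inj_to m n g \<Longrightarrow> inj_to l n (g \<circ> f)"
  unfolding inj_to_def by (auto intro!: comp_inj_on inj_on_subset[of g "{1..m}"])

lemma inj_to_id: "m \<le> n \<Longrightarrow> inj_to m n id"
  by (auto simp: inj_to_def)

lemma inj_to_permutes: "p permutes {1..n} \<Longrightarrow> inj_to n n p"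
  unfolding inj_to_def using permutes_in_image[of p "{1..n}"] permutes_inj_on[of p "{1..n}"] by blast

lemma inj_to_transpose:
  "m \<le> n \<Longrightarrow> x \<in> {1..n} \<Longrightarrow> y \<in> {1..n} \<Longrightarrow> inj_to m n (transpose x y)"
  by (auto simp: inj_to_def transpose_def)

lemma restrict_in_FI_hom: "inj_to m n f \<Longrightarrow> restrict f {1..m} \<in> FI_hom m n"
  unfolding inj_to_def FI_hom_def
  by (auto simp only: mem_Collect_eq inj_on_restrict_eq restrict_PiE_iff)

section \<open>Action of injections on vertices, and the transpositions fixing a vertex\<close>

context FI_graph
begin

abbreviation "V n \<equiv> pverts (G n)"

lemma finite_V: "finite (V n)"
  using graph[of n] unfolding pair_graph_def pair_digraph_def
  by (blast dest: pair_fin_digraph.pair_finite_verts)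

definition push :: "nat \<Rightarrow> nat \<Rightarrow> (nat \<Rightarrow> nat) \<Rightarrow> 'a \<Rightarrow> 'a" where
  "push m n f = Gmap m n (restrict f {1..m})"

lemma push_hom: "inj_to m n f \<Longrightarrow> push m n f \<in> graph_hom (G m) (G n)"
  unfolding push_def by (intro Gmap_hom restrict_in_FI_hom)

lemma push_mem: "inj_to m n f \<Longrightarrow> v \<in> V m \<Longrightarrow> push m n f v \<in> V n"
  using push_hom unfolding graph_hom_def by blast

lemma push_arc:
  "inj_to m n f \<Longrightarrow> (u, v) \<in> parcs (G m) \<Longrightarrow> (push m n f u, push m n f v) \<in> parcs (G n)"
  using push_hom unfolding graph_hom_def by blast

lemma push_id: "v \<in> V n \<Longrightarrow> push n n id v = v"
  unfolding push_def Gmap_id by simp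

lemma push_push:
  assumes "inj_to l m f" "inj_to m n g" "v \<in> V l"
  shows "push m n g (push l m f v) = push l n (g \<circ> f) v"
proof -
  have "restrict f {1..l} \<in> FI_hom l m" "restrict g {1..m} \<in> FI_hom m n"
    using assms by (simp_all only: restrict_in_FI_hom)
  then have "Gmap l n (compose {1..l} (restrict g {1..m}) (restrict f {1..l})) v =
      push m n g (push l m f v)"
    unfolding push_def by (simp only: Gmap_compose compose_eq[OF assms(3)])
  moreover have "compose {1..l} (restrict g {1..m}) (restrict f {1..l}) = restrict (g \<circ> f) {1..l}"
    using inj_to_mem[OF assms(1)] by (auto simp: compose_def fun_eq_iff)
  ultimately show ?thesis by (simp add: push_def)
qed

lemma push_cong: "(\<And>x. x \<in> {1..m} \<Longrightarrow> f x = g x) \<Longrightarrow> push m n f v = push m n g v"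
  unfolding push_def by (metis restrict_ext)

lemma push_transpose:
  assumes "inj_to l n f" "x \<in> {1..n}" "y \<in> {1..n}" "v \<in> V l"
  shows "push n n (transpose x y) (push l n f v) = push l n (transpose x y \<circ> f) v"
  using assms by (intro push_push inj_to_transpose order_refl)

definition swap_class :: "nat \<Rightarrow> 'a \<Rightarrow> nat \<Rightarrow> nat set" where
  "swap_class n v x = {y \<in> {1..n}. push n n (transpose x y) v = v}"

lemma swap_class_sym: "x \<in> {1..n} \<Longrightarrow> y \<in> swap_class n v x \<Longrightarrow> x \<in> swap_class n v y"
  by (simp add: swap_class_def transpose_commute)

text \<open>The transposition of \<open>x\<close> and \<open>z\<close> is the conjugate of that of
  \<open>y\<close> and \<open>z\<close> by that of \<open>x\<close> and \<open>y\<close>. This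
  identity needs \<open>z\<close> to differ from \<open>x\<close> and \<open>y\<close>, whence the
  case split.\<close>

lemma swap_class_trans:
  assumes v: "v \<in> V n" and x: "x \<in> {1..n}"
    and y: "y \<in> swap_class n v x" and z: "z \<in> swap_class n v y"
  shows "z \<in> swap_class n v x"
proof -
  have mem: "y \<in> {1..n}" "z \<in> {1..n}" using y z by (auto simp: swap_class_def)
  have fixed: "push n n (transpose x y) v = v" "push n n (transpose y z) v = v"
    using y z by (auto simp: swap_class_def)
  consider "x = z" | "y = z" | "x \<noteq> z" "y \<noteq> z" by blast
  then have "push n n (transpose x z) v = v"
  proof cases
    case 1
    then show ?thesis by (simp add: push_id v)
  next
    case 2
    then show ?thesis using fixed by simp
  next
    case 3
    have "push n n (transpose x z) v = push n n (transpose x y \<circ> (transpose y z \<circ> transpose x y)) v"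
      using transpose_comp_triple[OF 3] by (simp add: comp_assoc)
    also have "\<dots> = push n n (transpose x y) (push n n (transpose y z) (push n n (transpose x y) v))"
    proof -
      have "inj_to n n (transpose x y)" "inj_to n n (transpose y z)"
        using x mem by (auto intro: inj_to_transpose)
      then show ?thesis using x mem v by (metis push_transpose inj_to_comp)
    qed
    finally show ?thesis by (simp add: fixed)
  qed
  then show ?thesis using mem by (simp add: swap_class_def)
qed

text \<open>On \<open>{1..m}\<close>, swapping \<open>g x\<close> and \<open>g y\<close> after
  \<open>g\<close> is the same as swapping \<open>x\<close> and \<open>y\<close> before
  \<open>g\<close>.\<close>

lemma swap_class_push:
  assumes g: "inj_to m n g" and v: "v \<in> V m" and x: "x \<in> {1..m}" and y: "y \<in> swap_class m v x"
  shows "g y \<in> swap_class n (push m n g v) (g x)"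
proof -
  have y': "y \<in> {1..m}" "push m m (transpose x y) v = v" using y by (auto simp: swap_class_def)
  have "push n n (transpose (g x) (g y)) (push m n g v) = push m n (transpose (g x) (g y) \<circ> g) v"
    using g v x y' by (intro push_transpose inj_to_mem[OF g])
  also have "\<dots> = push m n (g \<circ> transpose x y) v"
    using inj_to_eq_iff[OF g] x y' by (intro push_cong) (auto simp: transpose_def)
  also have "\<dots> = push m n g (push m m (transpose x y) v)"
    by (rule push_push[symmetric, OF inj_to_transpose[OF order_refl x y'(1)] g v])
  finally show ?thesis using y' inj_to_mem[OF g y'(1)] by (simp add: swap_class_def)
qed

end

section \<open>Supports of vertices\<close>

locale generated_FI_graph = FI_graph +
  fixes N :: nat
  assumes generated: "N \<le> n \<Longrightarrow> v \<in> V n \<Longrightarrow> \<exists>w\<in>V N. \<exists>f. inj_to N n f \<and> v = push N n f w"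
begin

lemma generatedE:
  assumes "2 * N < n" "v \<in> V n"
  obtains w f where "w \<in> V N" "inj_to N n f" "v = push N n f w"
proof -
  have "N \<le> n" using assms(1) by simp
  then show ?thesis using generated[OF _ assms(2)] that by blast
qed

text \<open>For \<open>n > 2 * N\<close> the transpositions fixing \<open>v\<close> define an equivalence relation on \<open>[n]\<close> with
  exactly one class of more than \<open>N\<close> elements; the support of \<open>v\<close> is the complement of that class.\<close>

definition supp :: "nat \<Rightarrow> 'a \<Rightarrow> nat set" where
  "supp n v = {x \<in> {1..n}. card (swap_class n v x) \<le> N}"

lemma finite_supp: "finite (supp n v)"
  by (simp add: supp_def)

text \<open>A transposition of two points outside the image of \<open>f\<close> does not change
  \<open>f\<close> on \<open>{1..N}\<close>.\<close>

lemma big_swap_class: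
  assumes f: "inj_to N n f" and w: "w \<in> V N" and x: "x \<in> {1..n} - f ` {1..N}"
  shows "{1..n} - f ` {1..N} \<subseteq> swap_class n (push N n f w) x"
proof
  fix y assume y: "y \<in> {1..n} - f ` {1..N}"
  have "push n n (transpose x y) (push N n f w) = push N n (transpose x y \<circ> f) w"
    using x y by (intro push_transpose f w) blast+
  also have "\<dots> = push N n f w"
    using x y by (intro push_cong) (auto simp: transpose_def)
  finally show "y \<in> swap_class n (push N n f w) x" using y by (simp add: swap_class_def)
qed

lemma card_outside_image:
  assumes "2 * N < n" "inj_to N n f"
  shows "N < card ({1..n} - f ` {1..N})"
proof -
  have "card ({1..n} - f ` {1..N}) = n - N"
    using assms(2) by (subst card_Diff_subset) (auto simp: inj_to_def card_image)
  then show ?thesis using assms(1) by simp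
qed

text \<open>All points outside the image lie in a common class, which has at least
  \<open>n - N > N\<close> elements.\<close>

lemma supp_subset_image:
  assumes "2 * N < n" "inj_to N n f" "w \<in> V N"
  shows "supp n (push N n f w) \<subseteq> f ` {1..N}"
proof
  fix x assume x: "x \<in> supp n (push N n f w)"
  show "x \<in> f ` {1..N}"
  proof (rule ccontr)
    assume "x \<notin> f ` {1..N}"
    then have "card ({1..n} - f ` {1..N}) \<le> card (swap_class n (push N n f w) x)"
      using x assms by (intro card_mono big_swap_class) (auto simp: supp_def swap_class_def)
    then show False using card_outside_image[OF assms(1,2)] x by (simp add: supp_def)
  qed
qed

lemma card_supp_le:
  assumes "2 * N < n" "v \<in> V n"
  shows "card (supp n v) \<le> N"
proof -
  obtain w f where w: "w \<in> V N" "inj_to N n f" "v = push N n f w"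
    using generatedE[OF assms] by blast
  then have "card (supp n v) \<le> card (f ` {1..N})"
    using supp_subset_image[OF assms(1)] by (intro card_mono) auto
  also have "\<dots> \<le> N" using card_image_le[of "{1..N}" f] by simp
  finally show ?thesis .
qed

text \<open>A class of more than \<open>N\<close> elements does not fit into the image of a
  generating injection. It therefore meets the complement of that image, whose points are all
  equivalent, so there is only one large class.\<close>

lemma swap_outside_supp:
  assumes n: "2 * N < n" and v: "v \<in> V n" and x: "x \<in> {1..n} - supp n v" and y: "y \<in> {1..n} - supp n v"
  shows "push n n (transpose x y) v = v"
proof -
  obtain w f where w: "w \<in> V N" "inj_to N n f" "v = push N n f w"
    using generatedE[OF n v] by blast
  have meets: "\<exists>x'. x' \<in> swap_class n v x \<and> x' \<in> {1..n} - f ` {1..N}" if x: "x \<in> {1..n} - supp n v" for x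
  proof (rule ccontr)
    assume "\<nexists>x'. x' \<in> swap_class n v x \<and> x' \<in> {1..n} - f ` {1..N}"
    then have "swap_class n v x \<subseteq> f ` {1..N}" by (auto simp: swap_class_def)
    then have "card (swap_class n v x) \<le> card (f ` {1..N})" by (intro card_mono) auto
    also have "\<dots> \<le> N" using card_image_le[of "{1..N}" f] by simp
    finally show False using x by (auto simp: supp_def)
  qed
  obtain x' y' where x': "x' \<in> swap_class n v x" "x' \<in> {1..n} - f ` {1..N}"
    and y': "y' \<in> swap_class n v y" "y' \<in> {1..n} - f ` {1..N}"
    using meets[OF x] meets[OF y] by blast
  have "y' \<in> swap_class n v x'" using big_swap_class[OF w(2,1) x'(2)] y'(2) w(3) by blast
  moreover have "y \<in> swap_class n v y'" using y by (intro swap_class_sym[OF _ y'(1)]) blast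
  moreover have "x \<in> {1..n}" "x' \<in> {1..n}" using x x' by blast+
  ultimately have "y \<in> swap_class n v x"
    using swap_class_trans[OF v] x'(1) by blast
  then show ?thesis by (simp add: swap_class_def)
qed

text \<open>The pushed vertex is generated along \<open>g \<circ> f\<close>, so its support lies in
  the image of \<open>g\<close>. Since \<open>g\<close> embeds the class of \<open>z\<close> into
  the class of \<open>g z\<close>, a small class at \<open>g z\<close> forces a small one at
  \<open>z\<close>.\<close>

lemma supp_push_subset:
  assumes m: "2 * N < m" and g: "inj_to m n g" and v: "v \<in> V m"
  shows "supp n (push m n g v) \<subseteq> g ` supp m v"
proof
  fix x assume x: "x \<in> supp n (push m n g v)"
  have n: "2 * N < n" using m inj_to_le[OF g] by simp
  obtain w f where w: "w \<in> V N" "inj_to N m f" "v = push N m f w"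
    using generatedE[OF m v] by blast
  then have "push m n g v = push N n (g \<circ> f) w" using push_push[OF w(2) g w(1)] by simp
  then have "x \<in> (g \<circ> f) ` {1..N}"
    using supp_subset_image[OF n inj_to_comp[OF w(2) g] w(1)] x by auto
  then obtain z where z: "x = g z" "z \<in> {1..m}"
    using inj_to_mem[OF w(2)] by (metis comp_apply imageE)
  have "inj_on g (swap_class m v z)"
    using g unfolding inj_to_def by (rule inj_on_subset[OF conjunct1]) (auto simp: swap_class_def)
  then have "card (swap_class m v z) = card (g ` swap_class m v z)" by (rule card_image[symmetric])
  also have "\<dots> \<le> card (swap_class n (push m n g v) x)"
  proof (rule card_mono)
    show "finite (swap_class n (push m n g v) x)" by (simp add: swap_class_def)
    show "g ` swap_class m v z \<subseteq> swap_class n (push m n g v) x"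
      using swap_class_push[OF g v z(2)] z(1) by blast
  qed
  also have "\<dots> \<le> N" using x by (simp add: supp_def)
  finally show "x \<in> g ` supp m v" using z by (simp add: supp_def)
qed

lemma supp_push_permutation:
  assumes n: "2 * N < n" and p: "p permutes {1..n}" and v: "v \<in> V n"
  shows "supp n (push n n p v) = p ` supp n v"
proof
  show "supp n (push n n p v) \<subseteq> p ` supp n v"
    using supp_push_subset[OF n inj_to_permutes[OF p] v] .
  have inv: "inv p permutes {1..n}" using p by (rule permutes_inv)
  have "push n n (inv p) (push n n p v) = v"
    using push_push[OF inj_to_permutes[OF p] inj_to_permutes[OF inv] v] permutes_inv_o(2)[OF p]
      push_id[OF v] by simp
  then have "supp n v \<subseteq> inv p ` supp n (push n n p v)"
    using supp_push_subset[OF n inj_to_permutes[OF inv] push_mem[OF inj_to_permutes[OF p] v]] by simp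
  then have "p ` supp n v \<subseteq> p ` inv p ` supp n (push n n p v)" by (rule image_mono)
  then show "p ` supp n v \<subseteq> supp n (push n n p v)"
    using permutes_inv_o(1)[OF p] by (simp add: image_comp)
qed

text \<open>Such a permutation is a product of transpositions of points outside the support.\<close>

lemma push_permutation_fixing_supp:
  assumes n: "2 * N < n" and p: "p permutes {1..n} - supp n v" and v: "v \<in> V n"
  shows "push n n p v = v"
proof -
  have "finite ({1..n} - supp n v)" by simp
  with p show ?thesis
  proof (induction rule: permutes_induct)
    case (swap a b p)
    have "p permutes {1..n}" using swap by (auto intro: permutes_subset)
    then have "push n n (transpose a b \<circ> p) v = push n n (transpose a b) (push n n p v)"
      using swap v by (intro push_transpose[symmetric] inj_to_permutes) blast+
    also have "\<dots> = v" using swap swap_outside_supp[OF n v] by simp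
    finally show ?case .
  qed (rule push_id[OF v])
qed

text \<open>Some permutation of \<open>{1..n}\<close> carries \<open>f\<close> to \<open>g\<close>.
  It fixes the image of the support of \<open>v\<close>, which contains the support of the pushed
  vertex.\<close>

lemma push_eq_if_agree_on_supp:
  assumes m: "2 * N < m" and f: "inj_to m n f" and g: "inj_to m n g" and v: "v \<in> V m"
    and agree: "\<And>x. x \<in> supp m v \<Longrightarrow> f x = g x"
  shows "push m n f v = push m n g v"
proof -
  have n: "2 * N < n" using m inj_to_le[OF f] by simp
  obtain p where p: "p permutes {1..n}" and pf: "\<And>x. x \<in> {1..m} \<Longrightarrow> p (f x) = g x"
    using ex_permutation_extending[of "{1..n}" f "{1..m}" g] f g unfolding inj_to_def
    by (metis finite_atLeastAtMost image_subset_iff_funcset)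
  have "p permutes {1..n} - supp n (push m n f v)"
  proof (rule permutes_superset[OF p])
    fix x assume "x \<in> {1..n} - ({1..n} - supp n (push m n f v))"
    then obtain z where "x = f z" "z \<in> supp m v" using supp_push_subset[OF m f v] by blast
    then show "p x = x" using pf[of z] agree by (simp add: supp_def)
  qed
  then have "push n n p (push m n f v) = push m n f v"
    using push_permutation_fixing_supp[OF n] push_mem[OF f v] by blast
  moreover have "push n n p (push m n f v) = push m n g v"
    using push_push[OF f inj_to_permutes[OF p] v] push_cong[of m "p \<circ> f" g n v] pf by simp
  ultimately show ?thesis by simp
qed

section \<open>Orbit sizes under linear growth\<close>

text \<open>Permutations carry the support of \<open>v\<close> to every subset of
  \<open>{1..n}\<close> of the same size, and vertices with different supports are
  different.\<close>

lemma choose_card_supp_le: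
  assumes n: "2 * N < n" and v: "v \<in> V n"
  shows "n choose card (supp n v) \<le> card (V n)"
proof -
  have "{B. B \<subseteq> {1..n} \<and> card B = card (supp n v)} \<subseteq> supp n ` V n"
  proof clarify
    fix B assume B: "B \<subseteq> {1..n}" "card B = card (supp n v)"
    then obtain h where h: "bij_betw h (supp n v) B"
      using finite_same_card_bij[OF finite_supp, of B n v] finite_subset[OF B(1)] by auto
    then have "inj_on h (supp n v)" "h ` supp n v \<subseteq> {1..n}" using B(1) by (auto simp: bij_betw_def)
    moreover have "id ` supp n v \<subseteq> {1..n}" by (auto simp: supp_def)
    ultimately obtain p where p: "p permutes {1..n}" "\<And>x. x \<in> supp n v \<Longrightarrow> p (id x) = h x"
      using ex_permutation_extending[OF finite_atLeastAtMost inj_on_id] by metis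
    then have "supp n (push n n p v) = B"
      using h supp_push_permutation[OF n p(1) v] by (simp add: bij_betw_def)
    then show "B \<in> supp n ` V n" using push_mem[OF inj_to_permutes[OF p(1)] v] by blast
  qed
  then have "card {B. B \<subseteq> {1..n} \<and> card B = card (supp n v)} \<le> card (V n)"
    by (rule surj_card_le[OF finite_V])
  then show ?thesis by (simp add: n_subsets)
qed

lemma card_supp_le_1:
  assumes n: "2 * N < n" "2 * \<bar>a\<bar> + 2 * \<bar>c\<bar> + 2 \<le> int n"
    and card_V: "int (card (V n)) = a * int n + c"
    and v: "v \<in> V n"
  shows "card (supp n v) \<le> 1"
proof (rule ccontr)
  assume "\<not> card (supp n v) \<le> 1"
  \<comment> \<open>Binomial coefficients increase up to the middle, and the support has at most
    \<open>N < n / 2\<close> elements.\<close>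
  then have "n choose 2 \<le> n choose card (supp n v)"
    using card_supp_le[OF n(1) v] n(1) by (intro binomial_mono) auto
  also note choose_card_supp_le[OF n(1) v]
  finally have le: "int (n choose 2) \<le> a * int n + c" using card_V by linarith
  have "2 * (n choose 2) = n * (n - 1)"
    unfolding choose_two by (rule dvd_mult_div_cancel) (cases "even n"; simp)
  then have "int (2 * (n choose 2)) = int (n * (n - 1))" by (rule arg_cong)
  then have "int n * (int n - 1) = 2 * int (n choose 2)"
    using n(1) by (simp add: of_nat_diff)
  also have "\<dots> \<le> 2 * (a * int n + c)" using le by simp
  finally have "int n * (int n - 1) \<le> 2 * (a * int n + c)" .
  \<comment> \<open>The threshold on \<open>n\<close> is chosen so that \<open>n * (n - 1)\<close>
    exceeds \<open>2 * (a * n + c)\<close>.\<close>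
  moreover have "int n * (2 * \<bar>a\<bar> + 2 * \<bar>c\<bar> + 1) \<le> int n * (int n - 1)"
    using n(2) by (intro mult_left_mono) auto
  moreover have "a * int n \<le> \<bar>a\<bar> * int n" by (intro mult_right_mono) auto
  moreover have "c \<le> \<bar>c\<bar> * int n"
    using n(1) mult_left_mono[of 1 "int n" "\<bar>c\<bar>"] by linarith
  ultimately show False using n(2) by (simp add: algebra_simps)
qed

end

section \<open>Vertices supported on single points\<close>

locale point_supported_FI_graph = generated_FI_graph +
  fixes L :: nat
  assumes L: "2 * N < L" "2 \<le> L"
    and card_supp: "L \<le> n \<Longrightarrow> v \<in> V n \<Longrightarrow> card (supp n v) \<le> 1"
begin

definition pointed :: "nat \<Rightarrow> 'a set" where
  "pointed n = {v \<in> V n. supp n v \<subseteq> {1}}"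

definition invariant :: "nat \<Rightarrow> 'a set" where
  "invariant n = {v \<in> V n. supp n v = {}}"

definition moving :: "nat \<Rightarrow> 'a set" where
  "moving n = pointed n - invariant n"

text \<open>For pointed \<open>w\<close> and \<open>k\<close> at least \<open>L\<close>, any
  injection sending 1 to \<open>x\<close> gives the same vertex; the transposition is a convenient
  choice.\<close>

definition spread :: "nat \<Rightarrow> nat \<Rightarrow> nat \<Rightarrow> 'a \<Rightarrow> 'a" where
  "spread k n x w = push k n (transpose 1 x) w"

lemma finite_pointed: "finite (pointed n)"
  unfolding pointed_def using finite_V by simp

lemma pointed_V: "w \<in> pointed n \<Longrightarrow> w \<in> V n"
  by (simp add: pointed_def)

lemma invariant_pointed: "w \<in> invariant n \<Longrightarrow> w \<in> pointed n"
  by (simp add: pointed_def invariant_def)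

lemma large: "L \<le> k \<Longrightarrow> 2 * N < k"
  using L(1) by simp

lemma one_mem: "L \<le> k \<Longrightarrow> 1 \<in> {1..k}"
  using L(2) by simp

lemma inj_to_transpose_1: "L \<le> k \<Longrightarrow> k \<le> n \<Longrightarrow> x \<in> {1..n} \<Longrightarrow> inj_to k n (transpose 1 x)"
  using L(2) by (intro inj_to_transpose) simp_all

lemma spread_mem:
  "L \<le> k \<Longrightarrow> k \<le> n \<Longrightarrow> x \<in> {1..n} \<Longrightarrow> w \<in> pointed k \<Longrightarrow> spread k n x w \<in> V n"
  unfolding spread_def by (intro push_mem inj_to_transpose_1 pointed_V)

lemma supp_spread:
  assumes "L \<le> k" "k \<le> n" "x \<in> {1..n}" "w \<in> pointed k"
  shows "supp n (spread k n x w) \<subseteq> {x}"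
proof -
  have "supp n (spread k n x w) \<subseteq> transpose 1 x ` supp k w"
    unfolding spread_def
    using supp_push_subset[OF large[OF assms(1)] inj_to_transpose_1[OF assms(1-3)] pointed_V[OF assms(4)]] .
  also have "\<dots> \<subseteq> transpose 1 x ` {1}" using assms(4) by (intro image_mono) (simp add: pointed_def)
  finally show ?thesis by simp
qed

text \<open>Both injections send 1 to \<open>g x\<close>, and 1 is the only possible point of the
  support of \<open>w\<close>.\<close>

lemma push_spread:
  assumes "L \<le> k" "k \<le> n" "x \<in> {1..n}" "w \<in> pointed k" and g: "inj_to n m g"
  shows "push n m g (spread k n x w) = spread k m (g x) w"
proof -
  note inj = inj_to_transpose_1[OF assms(1-3)]
  have "push n m g (spread k n x w) = push k m (g \<circ> transpose 1 x) w"
    unfolding spread_def using push_push[OF inj g pointed_V[OF assms(4)]] .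
  also have "\<dots> = push k m (transpose 1 (g x)) w"
  proof (rule push_eq_if_agree_on_supp[OF large[OF assms(1)] inj_to_comp[OF inj g]])
    show "inj_to k m (transpose 1 (g x))"
      using assms(1,2) inj_to_le[OF g] inj_to_mem[OF g assms(3)] by (intro inj_to_transpose_1) simp_all
    show "w \<in> V k" using pointed_V[OF assms(4)] .
    show "(g \<circ> transpose 1 x) y = transpose 1 (g x) y" if "y \<in> supp k w" for y
    proof -
      have "y = 1" using that assms(4) by (auto simp: pointed_def)
      then show ?thesis by simp
    qed
  qed
  finally show ?thesis by (simp add: spread_def)
qed

lemma push_transpose_1_spread:
  assumes "L \<le> k" "k \<le> n" "x \<in> {1..n}" "w \<in> pointed k"
  shows "push n n (transpose 1 x) (spread k n x w) = spread k n 1 w"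
  using push_spread[OF assms inj_to_transpose_1[OF _ order_refl assms(3)]] assms(1,2) by simp

text \<open>With empty support the vertex is fixed by every permutation, in particular by the one
  moving \<open>x\<close> to 1.\<close>

lemma spread_invariant_value:
  assumes "L \<le> k" "k \<le> n" "x \<in> {1..n}" "w \<in> pointed k" and empty: "supp n (spread k n x w) = {}"
  shows "spread k n x w = spread k n 1 w"
proof -
  have n: "L \<le> n" using assms(1,2) by simp
  have "transpose 1 x permutes {1..n} - supp n (spread k n x w)"
    unfolding empty using one_mem[OF n] assms(3) by (simp add: permutes_swap_id)
  then have "push n n (transpose 1 x) (spread k n x w) = spread k n x w"
    by (intro push_permutation_fixing_supp large[OF n] spread_mem assms)
  then show ?thesis using push_transpose_1_spread[OF assms(1-4)] by simp
qed

text \<open>A permutation extending a generating injection of \<open>v\<close> factors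
  \<open>v\<close> through stage \<open>k\<close>. There the support has at most one point, which is
  moved to 1.\<close>

lemma spread_surj:
  assumes k: "L \<le> k" "k \<le> n" and v: "v \<in> V n"
  obtains x w where "x \<in> {1..n}" "w \<in> pointed k" "v = spread k n x w"
proof -
  have large_kn: "2 * N < k" "2 * N < n" "N \<le> k" using large[OF k(1)] k by auto
  obtain w0 f where w0: "w0 \<in> V N" "inj_to N n f" "v = push N n f w0"
    using generatedE[OF large_kn(2) v] by blast
  have id_sub: "id ` {1..N} \<subseteq> {1..n}" and f_sub: "f ` {1..N} \<subseteq> {1..n}" and f_inj: "inj_on f {1..N}"
    using large_kn k w0(2) by (auto simp: inj_to_def)
  obtain p where p: "p permutes {1..n}" "\<And>x. x \<in> {1..N} \<Longrightarrow> p (id x) = f x"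
    using ex_permutation_extending[OF _ inj_on_id id_sub f_inj f_sub] by (metis finite_atLeastAtMost)
  define u where "u = push N k id w0"
  have u: "u \<in> V k" unfolding u_def by (intro push_mem inj_to_id large_kn w0)
  have p_inj: "inj_to k n p"
    using inj_to_comp[OF inj_to_id[OF k(2)] inj_to_permutes[OF p(1)]] by simp
  have v_eq: "v = push k n p u"
    using push_push[OF inj_to_id[OF large_kn(3)] p_inj w0(1)] push_cong[of N "p \<circ> id" f n w0] p(2) w0(3)
    by (simp add: u_def)
  have "\<exists>y\<in>{1..k}. supp k u \<subseteq> {y}"
  proof (cases "supp k u = {}")
    case True
    then show ?thesis using one_mem[OF k(1)] by blast
  next
    case False
    then have "card (supp k u) = 1"
      using card_supp[OF k(1) u] finite_supp[of k u] by (simp add: le_Suc_eq One_nat_def)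
    then obtain y where "supp k u = {y}" by (rule card_1_singletonE)
    moreover from this have "y \<in> {1..k}" by (auto simp: supp_def)
    ultimately show ?thesis by blast
  qed
  then obtain y where y: "y \<in> {1..k}" "supp k u \<subseteq> {y}" by blast
  have inj: "inj_to k k (transpose 1 y)" by (rule inj_to_transpose_1[OF k(1) order_refl y(1)])
  define w where "w = push k k (transpose 1 y) u"
  have "supp k w \<subseteq> transpose 1 y ` supp k u"
    unfolding w_def by (rule supp_push_subset[OF large_kn(1) inj u])
  also have "\<dots> \<subseteq> transpose 1 y ` {y}" by (rule image_mono[OF y(2)])
  finally have w: "w \<in> pointed k" using push_mem[OF inj u] by (simp add: pointed_def w_def)
  have "u = spread k k y w"
    using push_push[OF inj inj u] push_id[OF u] by (simp add: spread_def w_def)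
  then have "v = spread k n (p y) w"
    using push_spread[OF k(1) order_refl y(1) w p_inj] v_eq by simp
  then show ?thesis using that[OF inj_to_mem[OF p_inj y(1)] w] by blast
qed

text \<open>A vertex spread from a point other than 1 but supported in \<open>{1}\<close> has empty
  support, so it may be spread from 1 instead.\<close>

lemma pointed_subset:
  assumes k: "L \<le> k" "k \<le> n"
  shows "pointed n \<subseteq> spread k n 1 ` pointed k"
proof
  fix v assume v: "v \<in> pointed n"
  obtain x w where x: "x \<in> {1..n}" and w: "w \<in> pointed k" and v_eq: "v = spread k n x w"
    using spread_surj[OF k pointed_V[OF v]] by blast
  have "v = spread k n 1 w"
  proof (cases "x = 1")
    case False
    then have "supp n (spread k n x w) = {}"
      using supp_spread[OF k x w] v unfolding v_eq pointed_def by blast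
    then show ?thesis using spread_invariant_value[OF k x w] v_eq by simp
  qed (simp add: v_eq)
  then show "v \<in> spread k n 1 ` pointed k" using w by blast
qed

lemma spread_1_invariant:
  assumes k: "L \<le> k" "k \<le> n" and w: "w \<in> invariant k"
  shows "spread k n 1 w \<in> invariant n"
proof -
  have x: "1 \<in> {1..n}" using one_mem[of n] k by simp
  have "supp n (spread k n 1 w) \<subseteq> transpose 1 1 ` supp k w"
    unfolding spread_def
    using supp_push_subset[OF large[OF k(1)] inj_to_transpose_1[OF k x] pointed_V[OF invariant_pointed[OF w]]] .
  then show ?thesis
    using w spread_mem[OF k x invariant_pointed[OF w]] by (simp add: invariant_def)
qed

lemma moving_subset:
  assumes k: "L \<le> k" "k \<le> n"
  shows "moving n \<subseteq> spread k n 1 ` moving k"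
  using pointed_subset[OF k] spread_1_invariant[OF k] unfolding moving_def by blast

section \<open>Stabilization of vertices, adjacency and equality\<close>

text \<open>The numbers of pointed and of moving vertices are nonincreasing, so a minimum of their sum is a
  stage from which both are constant, and hence vertices neither merge nor become invariant.\<close>

lemma ex_stable:
  obtains K where "L \<le> K" "\<And>n. K \<le> n \<Longrightarrow> inj_on (spread K n 1) (pointed K)"
    "\<And>n. K \<le> n \<Longrightarrow> spread K n 1 ` moving K \<subseteq> moving n"
proof -
  let ?m = "\<lambda>n. card (pointed n) + card (moving n)"
  obtain K where K: "L \<le> K" and K_min: "\<And>n. L \<le> n \<Longrightarrow> ?m K \<le> ?m n"
    using ex_has_least_nat[of "\<lambda>n. L \<le> n" L ?m] by blast
  have fin: "finite (moving n)" for n using finite_pointed by (simp add: moving_def)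
  \<comment> \<open>Neither count can grow, so a sum that does not drop forces equality throughout
    both chains of inequalities.\<close>
  have stable: "card (spread K n 1 ` pointed K) = card (pointed K)"
    "card (moving n) = card (spread K n 1 ` moving K)" if n: "K \<le> n" for n
  proof -
    have "card (pointed n) \<le> card (spread K n 1 ` pointed K)"
      using pointed_subset[OF K n] finite_pointed by (intro card_mono) auto
    moreover have "card (moving n) \<le> card (spread K n 1 ` moving K)"
      using moving_subset[OF K n] fin by (intro card_mono) auto
    moreover have "card (spread K n 1 ` pointed K) \<le> card (pointed K)"
      "card (spread K n 1 ` moving K) \<le> card (moving K)"
      using finite_pointed fin by (auto intro: card_image_le)
    moreover have "?m K \<le> ?m n" using K_min n K by simp
    ultimately show "card (spread K n 1 ` pointed K) = card (pointed K)"
      "card (moving n) = card (spread K n 1 ` moving K)" by linarith+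
  qed
  show ?thesis
  proof (rule that[OF K])
    fix n assume n: "K \<le> n"
    show "inj_on (spread K n 1) (pointed K)"
      using stable(1)[OF n] finite_pointed by (intro eq_card_imp_inj_on)
    have "moving n = spread K n 1 ` moving K"
      using moving_subset[OF K n] stable(2)[OF n] fin by (intro card_subset_eq) auto
    then show "spread K n 1 ` moving K \<subseteq> moving n" by simp
  qed
qed

text \<open>Permutations act transitively on pairs of points with the same equality pattern.\<close>

lemma spread_arc_transfer:
  assumes k: "L \<le> k" "k \<le> n" and x: "x \<in> {1..n}" "x' \<in> {1..n}" and y: "y \<in> {1..n}" "y' \<in> {1..n}"
    and eq: "x = x' \<longleftrightarrow> y = y'" and w: "w \<in> pointed k" "w' \<in> pointed k"
    and arc: "(spread k n x w, spread k n x' w') \<in> parcs (G n)"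
  shows "(spread k n y w, spread k n y' w') \<in> parcs (G n)"
proof -
  \<comment> \<open>The first swap sends \<open>x\<close> to \<open>y\<close>; the second sends the
    displaced \<open>x'\<close> to \<open>y'\<close> and leaves \<open>y\<close> in place by
    \<open>eq\<close>.\<close>
  define g where "g = transpose (transpose x y x') y' \<circ> transpose x y"
  have g: "inj_to n n g"
    unfolding g_def using x y by (intro inj_to_comp[of n n] inj_to_transpose) (auto simp: transpose_def)
  have gx: "g x = y" "g x' = y'"
    using eq by (auto simp: g_def transpose_def)
  show ?thesis
    using push_arc[OF g arc] push_spread[OF k x(1) w(1) g] push_spread[OF k x(2) w(2) g] gx by simp
qed

text \<open>Inclusions of initial segments preserve arcs, so an arc that appears once stays at all
  later stages.\<close>

lemma eventually_spread_arc:
  assumes k: "L \<le> k" and x: "x \<in> {1..k}" "x' \<in> {1..k}" and w: "w \<in> pointed k" "w' \<in> pointed k"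
  shows "\<forall>\<^sub>F n in sequentially. (spread k n x w, spread k n x' w') \<in> parcs (G n) \<longleftrightarrow>
    (\<exists>m\<ge>k. (spread k m x w, spread k m x' w') \<in> parcs (G m))"
proof (cases "\<exists>m\<ge>k. (spread k m x w, spread k m x' w') \<in> parcs (G m)")
  case True
  then obtain m where m: "k \<le> m" "(spread k m x w, spread k m x' w') \<in> parcs (G m)" by blast
  have xm: "x \<in> {1..m}" "x' \<in> {1..m}" using x m(1) by auto
  have "(spread k n x w, spread k n x' w') \<in> parcs (G n)" if "m \<le> n" for n
    using push_arc[OF inj_to_id[OF that] m(2)] push_spread[OF k m(1) xm(1) w(1) inj_to_id[OF that]]
      push_spread[OF k m(1) xm(2) w(2) inj_to_id[OF that]] by simp
  then show ?thesis using True unfolding eventually_sequentially by blast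
next
  case False
  then show ?thesis unfolding eventually_sequentially by blast
qed

text \<open>Equal vertices at distinct points have empty support. Moving both to the point 1 then
  identifies \<open>w\<close> with \<open>w'\<close>, and \<open>w\<close> must be invariant because
  moving vertices stay moving.\<close>

lemma spread_eq_iff:
  assumes K: "L \<le> K" "K \<le> n" and inj: "inj_on (spread K n 1) (pointed K)"
    and moving: "spread K n 1 ` moving K \<subseteq> moving n"
    and x: "x \<in> {1..n}" and y: "y \<in> {1..n}" and w: "w \<in> pointed K" and w': "w' \<in> pointed K"
  shows "spread K n x w = spread K n y w' \<longleftrightarrow> w = w' \<and> (x = y \<or> w \<in> invariant K)"
proof
  assume eq: "spread K n x w = spread K n y w'"
  show "w = w' \<and> (x = y \<or> w \<in> invariant K)"
  proof (cases "x = y")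
    case True
    then have "spread K n 1 w = spread K n 1 w'"
      using eq push_transpose_1_spread[OF K x w] push_transpose_1_spread[OF K y w'] by simp
    then show ?thesis using True inj w w' by (simp add: inj_on_eq_iff)
  next
    case False
    then have empty: "supp n (spread K n x w) = {}"
      using supp_spread[OF K x w] supp_spread[OF K y w'] unfolding eq by blast
    then have val: "spread K n x w = spread K n 1 w" "spread K n x w = spread K n 1 w'"
      using spread_invariant_value[OF K x w] spread_invariant_value[OF K y w'] eq by simp_all
    then have "w = w'" using inj w w' by (simp add: inj_on_eq_iff)
    moreover have "spread K n 1 w \<in> invariant n"
      using empty val spread_mem[OF K x w] by (simp add: invariant_def)
    then have "w \<in> invariant K" using moving w unfolding moving_def by blast
    ultimately show ?thesis by simp
  qed
next
  assume rhs: "w = w' \<and> (x = y \<or> w \<in> invariant K)"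
  show "spread K n x w = spread K n y w'"
  proof (cases "x = y")
    case False
    then have "supp K w = {}" using rhs by (auto simp: invariant_def)
    then have "spread K n x w = spread K n y w" unfolding spread_def
      using push_eq_if_agree_on_supp[OF large[OF K(1)] inj_to_transpose_1[OF K x] inj_to_transpose_1[OF K y]]
        pointed_V[OF w] by blast
    then show ?thesis using rhs by simp
  qed (use rhs in simp)
qed

theorem independence_number_eventually_affine:
  "\<exists>A B :: int. \<forall>\<^sub>F n in sequentially. int (independence_number (G n)) = A * int n + B"
proof -
  obtain K where K: "L \<le> K" and inj: "\<And>n. K \<le> n \<Longrightarrow> inj_on (spread K n 1) (pointed K)"
    and moving: "\<And>n. K \<le> n \<Longrightarrow> spread K n 1 ` moving K \<subseteq> moving n"
    using ex_stable by blast
  \<comment> \<open>The pairs (1, 1) and (1, 2) represent the two equality patterns of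
    points.\<close>
  have K2: "1 \<in> {1..K}" "2 \<in> {1..K}" using K L(2) by auto
  define same where
    "same w w' \<longleftrightarrow> (\<exists>m\<ge>K. (spread K m 1 w, spread K m 1 w') \<in> parcs (G m))" for w w'
  define diff where
    "diff w w' \<longleftrightarrow> (\<exists>m\<ge>K. (spread K m 1 w, spread K m 2 w') \<in> parcs (G m))" for w w'
  have "\<forall>\<^sub>F n in sequentially. \<forall>w\<in>pointed K. \<forall>w'\<in>pointed K.
      ((spread K n 1 w, spread K n 1 w') \<in> parcs (G n) \<longleftrightarrow> same w w') \<and>
      ((spread K n 1 w, spread K n 2 w') \<in> parcs (G n) \<longleftrightarrow> diff w w')"
    unfolding same_def diff_def
    by (intro eventually_ball_finite finite_pointed ballI eventually_conj eventually_spread_arc K K2)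
  then obtain M where M: "\<And>n w w'. M \<le> n \<Longrightarrow> w \<in> pointed K \<Longrightarrow> w' \<in> pointed K \<Longrightarrow>
      ((spread K n 1 w, spread K n 1 w') \<in> parcs (G n) \<longleftrightarrow> same w w') \<and>
      ((spread K n 1 w, spread K n 2 w') \<in> parcs (G n) \<longleftrightarrow> diff w w')"
    unfolding eventually_sequentially by blast
  have union: "invariant K \<union> moving K = pointed K"
    using invariant_pointed unfolding moving_def by blast
  \<comment> \<open>The types are the pointed vertices of the stable stage \<open>K\<close>; the
    invariant ones do not see the point.\<close>
  have "eventual_blowup G (spread K) (invariant K) (moving K) same diff (max K M)"
  proof
    show "0 < max K M" using K2(1) by simp
    show "finite (invariant K)" "finite (moving K)"
      using finite_pointed[of K] union by (metis finite_Un)+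
    show "invariant K \<inter> moving K = {}" by (auto simp: moving_def)
  next
    fix n assume "max K M \<le> n"
    then have n: "K \<le> n" by simp
    show "V n = (\<lambda>(x, w). spread K n x w) ` ({1..n} \<times> (invariant K \<union> moving K))"
    proof (intro equalityI subsetI)
      fix v assume "v \<in> V n"
      then obtain x w where "x \<in> {1..n}" "w \<in> pointed K" "v = spread K n x w"
        using spread_surj[OF K n] by blast
      then show "v \<in> (\<lambda>(x, w). spread K n x w) ` ({1..n} \<times> (invariant K \<union> moving K))"
        unfolding union by blast
    next
      fix v assume "v \<in> (\<lambda>(x, w). spread K n x w) ` ({1..n} \<times> (invariant K \<union> moving K))"
      then show "v \<in> V n" unfolding union using spread_mem[OF K n] by auto
    qed
  next
    fix n x y w w'
    assume n: "max K M \<le> n" and x: "x \<in> {1..n}" and y: "y \<in> {1..n}"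
      and "w \<in> invariant K \<union> moving K" "w' \<in> invariant K \<union> moving K"
    then have Kn: "K \<le> n" and w: "w \<in> pointed K" "w' \<in> pointed K" using union by auto
    show "spread K n x w = spread K n y w' \<longleftrightarrow> w = w' \<and> (x = y \<or> w \<in> invariant K)"
      by (rule spread_eq_iff[OF K Kn inj[OF Kn] moving[OF Kn] x y w])
    have n12: "1 \<in> {1..n}" "2 \<in> {1..n}" using K2 Kn by auto
    have M': "(spread K n 1 w, spread K n 1 w') \<in> parcs (G n) \<longleftrightarrow> same w w'"
      "(spread K n 1 w, spread K n 2 w') \<in> parcs (G n) \<longleftrightarrow> diff w w'"
      using M[OF _ w] n by auto
    show "(spread K n x w, spread K n y w') \<in> parcs (G n) \<longleftrightarrow> (if x = y then same w w' else diff w w')"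
    proof (cases "x = y")
      case True
      then have "(spread K n x w, spread K n y w') \<in> parcs (G n) \<longleftrightarrow>
          (spread K n 1 w, spread K n 1 w') \<in> parcs (G n)"
        using spread_arc_transfer[OF K Kn x y n12(1) n12(1) _ w]
          spread_arc_transfer[OF K Kn n12(1) n12(1) x y _ w] by blast
      then show ?thesis using True M' by simp
    next
      case False
      then have "(spread K n x w, spread K n y w') \<in> parcs (G n) \<longleftrightarrow>
          (spread K n 1 w, spread K n 2 w') \<in> parcs (G n)"
        using spread_arc_transfer[OF K Kn x y n12 _ w]
          spread_arc_transfer[OF K Kn n12 x y _ w] by (metis numeral_eq_one_iff semiring_norm(85))
      then show ?thesis using False M' by simp
    qed
  qed
  then show ?thesis by (rule eventual_blowup.independence_number_eventually_affine)
qed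

end

section \<open>Reduction of the hypotheses to fixed stages\<close>

text \<open>Composing the generating injections of successive stages traces every later vertex back
  to one stage.\<close>

lemma (in FI_graph) ex_generated_FI_graph:
  assumes "finitely_generated G Gmap"
  obtains N where "generated_FI_graph G Gmap N"
proof -
  obtain N where N: "\<And>n v. N \<le> n \<Longrightarrow> v \<in> V (n + 1) \<Longrightarrow>
      \<exists>v'\<in>V n. \<exists>f\<in>FI_hom n (n + 1). Gmap n (n + 1) f v' = v"
    using assms unfolding finitely_generated_def eventually_sequentially by blast
  have successor: "\<exists>w\<in>V n. \<exists>f. inj_to n (Suc n) f \<and> v = push n (Suc n) f w"
    if n: "N \<le> n" and v: "v \<in> V (Suc n)" for n v
  proof -
    obtain w f where w: "w \<in> V n" "f \<in> FI_hom n (Suc n)" "Gmap n (Suc n) f w = v"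
      using N[OF n] v by (metis Suc_eq_plus1)
    have "restrict f {1..n} = f"
      using w(2) unfolding FI_hom_def by (auto intro: PiE_restrict)
    then have "v = push n (Suc n) f w" using w(3) by (simp add: push_def)
    moreover have "inj_to n (Suc n) f"
      using w(2) unfolding FI_hom_def inj_to_def by (auto simp: PiE_iff)
    ultimately show ?thesis using w(1) by blast
  qed
  have "generated_FI_graph G Gmap N"
  proof
    fix n v assume "N \<le> n" "v \<in> V n"
    then show "\<exists>w\<in>V N. \<exists>f. inj_to N n f \<and> v = push N n f w"
    proof (induction n arbitrary: v rule: dec_induct)
      case base
      then show ?case using push_id inj_to_id[of N N] by (metis order_refl)
    next
      case (step n)
      obtain u g where u: "u \<in> V n" "inj_to n (Suc n) g" "v = push n (Suc n) g u"
        using \<open>N \<le> n\<close> step.prems successor by blast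
      obtain w f where w: "w \<in> V N" "inj_to N n f" "u = push N n f w"
        using step.IH[OF u(1)] by blast
      have "v = push N (Suc n) (g \<circ> f) w" "inj_to N (Suc n) (g \<circ> f)"
        using push_push[OF w(2) u(2) w(1)] inj_to_comp[OF w(2) u(2)] u(3) w(3) by simp_all
      then show ?case using w(1) by blast
    qed
  qed
  then show ?thesis by (rule that)
qed

lemma (in generated_FI_graph) ex_point_supported_FI_graph:
  fixes a c :: int
  assumes "\<forall>\<^sub>F n in sequentially. int (card (V n)) = a * int n + c"
  obtains L where "point_supported_FI_graph G Gmap N L"
proof -
  obtain N' where N': "\<And>n. N' \<le> n \<Longrightarrow> int (card (V n)) = a * int n + c"
    using assms unfolding eventually_sequentially by blast
  \<comment> \<open>Large enough for the vertex count to be linear and for both thresholds of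
    \<open>card_supp_le_1\<close>.\<close>
  define L where "L = max N' (2 * N + nat (2 * \<bar>a\<bar> + 2 * \<bar>c\<bar> + 2))"
  have "point_supported_FI_graph G Gmap N L"
  proof
    show "2 * N < L" "2 \<le> L" by (simp_all add: L_def)
    fix n v assume n: "L \<le> n" and v: "v \<in> V n"
    have "2 * N < n" "2 * \<bar>a\<bar> + 2 * \<bar>c\<bar> + 2 \<le> int n" "N' \<le> n"
      using n unfolding L_def by linarith+
    then show "card (supp n v) \<le> 1" using card_supp_le_1 N' v by blast
  qed
  then show ?thesis by (rule that)
qed

theorem theorem1p4:
  fixes G :: "nat \<Rightarrow> 'a pair_pre_digraph"
    and Gmap :: "nat \<Rightarrow> nat \<Rightarrow> (nat \<Rightarrow> nat) \<Rightarrow> 'a \<Rightarrow> 'a"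
    and a c :: int
  assumes "FI_graph G Gmap"
    and "finitely_generated G Gmap"
    and "\<forall>\<^sub>F n in sequentially. int (card (pverts (G n))) = a * int n + c"
  shows "\<exists>A B :: int. \<forall>\<^sub>F n in sequentially. int (independence_number (G n)) = A * int n + B"
proof -
  obtain N where N: "generated_FI_graph G Gmap N"
    using FI_graph.ex_generated_FI_graph[OF assms(1,2)] .
  obtain L where "point_supported_FI_graph G Gmap N L"
    using generated_FI_graph.ex_point_supported_FI_graph[OF N assms(3)] .
  then show ?thesis by (rule point_supported_FI_graph.independence_number_eventually_affine)
qed

end
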